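(* Let $\rho = \rho_{AB}$ be a bipartite quantum state on $A\otimes B$, where $A\cong B\cong\mathbb{C}^d$, and write $\eta = D_H^2(\rho\|\rho_A\otimes\rho_B)$. Then $I(A:B)_\rho \le \eta\cdot O(\log(d/\eta))$.
   Context: $\rho_A,\rho_B$ denote the partial traces of $\rho$. $D_H^2(\rho\|\sigma) = \mathrm{tr}((\sqrt\rho-\sqrt\sigma)^2)$ is the squared quantum Hellinger distance. $I(A:B)_\rho = D_{KL}(\rho\|\rho_A\otimes\rho_B)$ with $D_{KL}(\rho\|\sigma) = \mathrm{tr}(\rho(\ln\rho-\ln\sigma))$. The $O(\cdot)$ hides a universal constant. *)

theory Defs
  imports Complex_Main "Jordan_Normal_Form.Matrix"
begin

definition mtrace :: "complex mat \<Rightarrow> complex" where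
  "mtrace A = (\<Sum>i<dim_row A. A $$ (i,i))"

definition adj :: "complex mat \<Rightarrow> complex mat" where
  "adj A = mat (dim_col A) (dim_row A) (\<lambda>(i,j). cnj (A $$ (j,i)))"

definition hermitian :: "complex mat \<Rightarrow> bool" where
  "hermitian A \<longleftrightarrow> dim_row A = dim_col A \<and> adj A = A"

definition unitary :: "complex mat \<Rightarrow> bool" where
  "unitary U \<longleftrightarrow> U \<in> carrier_mat (dim_row U) (dim_row U) \<and> adj U * U = 1\<^sub>m (dim_row U)"

definition psd :: "complex mat \<Rightarrow> bool" where
  "psd A \<longleftrightarrow> hermitian A \<and>
     (\<forall>v. dim_vec v = dim_row A \<longrightarrow> 0 \<le> Re (\<Sum>i<dim_row A. cnj (v $ i) * ((A *\<^sub>v v) $ i)))"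

definition density :: "complex mat \<Rightarrow> bool" where
  "density \<rho> \<longleftrightarrow> psd \<rho> \<and> mtrace \<rho> = 1"

definition real_diag :: "nat \<Rightarrow> (nat \<Rightarrow> real) \<Rightarrow> complex mat" where
  "real_diag n lam = mat n n (\<lambda>(i,j). if i = j then complex_of_real (lam i) else 0)"

definition mat_fun :: "(real \<Rightarrow> real) \<Rightarrow> complex mat \<Rightarrow> complex mat" where
  "mat_fun f A = (SOME B. \<exists>U lam. unitary U \<and> dim_row U = dim_row A \<and>
      A = U * real_diag (dim_row A) lam * adj U \<and>
      B = U * real_diag (dim_row A) (f \<circ> lam) * adj U)"

definition msqrt :: "complex mat \<Rightarrow> complex mat" where
  "msqrt A = mat_fun sqrt A"

definition mln :: "complex mat \<Rightarrow> complex mat" where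
  "mln A = mat_fun (\<lambda>x. if x > 0 then ln x else 0) A"

text \<open>Kronecker (tensor) product; index (i,j) of A \<otimes> B with B of size m is i*m+j.\<close>
definition kron :: "complex mat \<Rightarrow> complex mat \<Rightarrow> complex mat" where
  "kron A B = mat (dim_row A * dim_row B) (dim_col A * dim_col B)
     (\<lambda>(i,j). A $$ (i div dim_row B, j div dim_col B) * B $$ (i mod dim_row B, j mod dim_col B))"

text \<open>Partial traces of a state on C^d \<otimes> C^d (basis index a*d+b).\<close>
definition ptrace_B :: "nat \<Rightarrow> complex mat \<Rightarrow> complex mat" where
  "ptrace_B d \<rho> = mat d d (\<lambda>(i,j). \<Sum>k<d. \<rho> $$ (i*d+k, j*d+k))"

definition ptrace_A :: "nat \<Rightarrow> complex mat \<Rightarrow> complex mat" where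
  "ptrace_A d \<rho> = mat d d (\<lambda>(i,j). \<Sum>k<d. \<rho> $$ (k*d+i, k*d+j))"

definition hellinger_sq :: "complex mat \<Rightarrow> complex mat \<Rightarrow> real" where
  "hellinger_sq \<rho> \<sigma> = Re (mtrace ((msqrt \<rho> - msqrt \<sigma>) * (msqrt \<rho> - msqrt \<sigma>)))"

definition rel_entropy :: "complex mat \<Rightarrow> complex mat \<Rightarrow> real" where
  "rel_entropy \<rho> \<sigma> = Re (mtrace (\<rho> * (mln \<rho> - mln \<sigma>)))"

definition mutual_info :: "nat \<Rightarrow> complex mat \<Rightarrow> real" where
  "mutual_info d \<rho> = rel_entropy \<rho> (kron (ptrace_B d \<rho>) (ptrace_A d \<rho>))"

end

(* Diagonalise \<rho> with eigenvalues p i and \<rho>_A \<otimes> \<rho>_B with eigenvalues q j = a k * b l, and let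
   w i j be the squared overlaps of the two eigenbases (a doubly stochastic matrix).  Then the relative
   entropy and the Hellinger distance of the states are those of the classical distributions w i j * p i
   and w i j * q j (Nussbaum-Szkola).  Where p i \<le> R * q j, the entropy integrand exceeds w i j * (p i - q j)
   by at most a factor O(1 + ln R) times the Hellinger integrand.  The remaining terms have q j < 1 / R;
   there the weight r j = \<Sum>i. w i j * p i is at most sqrt (q j), because the r j have marginals a and b,
   so with R = (d / \<eta>)^8 they contribute at most O(\<eta>\<^sup>2) altogether.  The bound r j \<le> sqrt (q j) also gives
   \<eta> \<le> 2 - 2 / d\<^sup>2, which keeps ln (d / \<eta>) away from 0. *)
theory Submission
  imports Defs "Jordan_Normal_Form.Spectral_Radius" "Jordan_Normal_Form.Schur_Decomposition"
begin

section \<open>Hermitian matrices and their functions\<close>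

lemma adj_carrier [simp]: "A \<in> carrier_mat n m \<Longrightarrow> adj A \<in> carrier_mat m n"
  unfolding adj_def by auto

lemma dim_adj [simp]: "dim_row (adj A) = dim_col A" "dim_col (adj A) = dim_row A"
  unfolding adj_def by auto

lemma index_adj [simp]: "i < dim_col A \<Longrightarrow> j < dim_row A \<Longrightarrow> adj A $$ (i,j) = cnj (A $$ (j,i))"
  unfolding adj_def by auto

lemma adj_adj [simp]: "adj (adj A) = A"
  by (rule eq_matI) auto

lemma adj_one [simp]: "adj (1\<^sub>m n) = 1\<^sub>m n"
  by (rule eq_matI) auto

lemma index_mult_sum:
  "A \<in> carrier_mat n m \<Longrightarrow> B \<in> carrier_mat m k \<Longrightarrow> i < n \<Longrightarrow> j < k \<Longrightarrow>
    (A * B) $$ (i,j) = (\<Sum>l<m. A $$ (i,l) * B $$ (l,j))"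
  by (auto simp: scalar_prod_def atLeast0LessThan intro!: sum.cong)

lemma adj_mult:
  assumes "A \<in> carrier_mat n m" "B \<in> carrier_mat m k"
  shows "adj (A * B) = adj B * adj A"
proof (rule eq_matI)
  fix i j assume "i < dim_row (adj B * adj A)" "j < dim_col (adj B * adj A)"
  then have ij: "i < k" "j < n" using assms by auto
  have "adj (A * B) $$ (i,j) = cnj ((A * B) $$ (j,i))"
    using ij assms by simp
  also have "\<dots> = (\<Sum>l<m. cnj (A $$ (j,l)) * cnj (B $$ (l,i)))"
    using ij assms by (simp add: index_mult_sum[OF assms] del: index_mult_mat)
  also have "\<dots> = (adj B * adj A) $$ (i,j)"
    using ij assms
    by (subst index_mult_sum[of "adj B" k m "adj A" n])
      (auto intro!: sum.cong simp: mult.commute)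
  finally show "adj (A * B) $$ (i,j) = (adj B * adj A) $$ (i,j)" .
qed (use assms in auto)

lemma mult_carrier_square [simp]:
  "A \<in> carrier_mat n n \<Longrightarrow> B \<in> carrier_mat n n \<Longrightarrow> A * B \<in> carrier_mat n n"
  by (rule mult_carrier_mat)

lemma assoc_mult_square:
  "A \<in> carrier_mat n n \<Longrightarrow> B \<in> carrier_mat n n \<Longrightarrow> C \<in> carrier_mat n n \<Longrightarrow>
    A * B * C = A * (B * C)"
  by (rule assoc_mult_mat)

lemma unitaryD:
  assumes "unitary U" "U \<in> carrier_mat n n"
  shows "adj U * U = 1\<^sub>m n" "U * adj U = 1\<^sub>m n"
proof -
  show *: "adj U * U = 1\<^sub>m n" using assms unfolding unitary_def by auto
  show "U * adj U = 1\<^sub>m n"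
    by (rule mat_mult_left_right_inverse[OF _ assms(2) *]) (use assms in auto)
qed

lemma unitaryI: "U \<in> carrier_mat n n \<Longrightarrow> adj U * U = 1\<^sub>m n \<Longrightarrow> unitary U"
  unfolding unitary_def by auto

lemma unitary_adj:
  assumes "unitary U" "U \<in> carrier_mat n n"
  shows "unitary (adj U)"
  by (rule unitaryI[of _ n]) (use assms unitaryD[OF assms] in auto)

lemma unitary_mult:
  assumes "unitary U" "unitary V" "U \<in> carrier_mat n n" "V \<in> carrier_mat n n"
  shows "unitary (U * V)"
proof (rule unitaryI[of _ n])
  have "adj (U * V) * (U * V) = adj V * (adj U * U) * V"
    using assms by (simp add: adj_mult[of _ n n _ n] assoc_mult_square[of _ n])
  also have "\<dots> = 1\<^sub>m n" using assms unitaryD[of U n] unitaryD[of V n] by simp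
  finally show "adj (U * V) * (U * V) = 1\<^sub>m n" .
qed (use assms in auto)

section \<open>Diagonal matrices and the spectral theorem\<close>

lemma real_diag_carrier [simp]: "real_diag n lam \<in> carrier_mat n n"
  "dim_row (real_diag n lam) = n" "dim_col (real_diag n lam) = n"
  unfolding real_diag_def by auto

lemma index_real_diag [simp]:
  "i < n \<Longrightarrow> j < n \<Longrightarrow> real_diag n lam $$ (i,j) = (if i = j then complex_of_real (lam i) else 0)"
  unfolding real_diag_def by auto

text \<open>Every nonempty complex square matrix has an eigenvector. Extending it to a basis,
  orthogonalising and normalising gives a unitary whose column 0 is still an eigenvector; this is
  what one step of the spectral theorem needs.\<close>

lemma unit_eigenvector_completion:
  fixes A :: "complex mat"
  assumes A: "A \<in> carrier_mat n n" and n: "n > 0"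
  obtains U e where "U \<in> carrier_mat n n" "unitary U"
    "\<And>i. i < n \<Longrightarrow> (A * U) $$ (i,0) = e * U $$ (i,0)"
proof -
  obtain e where e: "eigenvalue A e"
    using spectrum_non_empty[OF A n] unfolding spectrum_def by auto
  then obtain v where ev: "eigenvector A v e" unfolding eigenvalue_def by auto
  then have v: "v \<in> carrier_vec n" and v0: "v \<noteq> 0\<^sub>v n" and Av: "A *\<^sub>v v = e \<cdot>\<^sub>v v"
    using A unfolding eigenvector_def by auto
  interpret cof_vec_space n "TYPE(complex)" .
  define b where "b = basis_completion v"
  define ws where "ws = gram_schmidt n b"
  define W where "W = mat_of_cols n ws"
  note bc = basis_completion[OF v v0, folded b_def]
  from bc n obtain vs where bv: "b = v # vs" by (cases b) auto
  note gs = gram_schmidt_result[OF bc(2,4,5) refl, folded ws_def]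
  \<comment> \<open>Gram-Schmidt leaves the first vector alone, so the eigenvector survives as
    column 0.\<close>
  have hdws: "hd ws = v" using gram_schmidt_hd[OF v, of vs, folded bv] unfolding ws_def .
  have len: "length ws = n" using gs bc by simp
  have W: "W \<in> carrier_mat n n" unfolding W_def using len by auto
  have orth: "corthogonal_mat W"
    unfolding W_def by (rule orthogonal_mat_of_cols[OF gs(3,2) len])
  have ip: "(\<Sum>k<n. W $$ (k,i) * cnj (W $$ (k,j))) = 0 \<longleftrightarrow> i \<noteq> j" if "i < n" "j < n" for i j
    using corthogonal_matD[OF orth, of i j] that W
    by (auto simp: scalar_prod_def atLeast0LessThan)
  \<comment> \<open>This Gram-Schmidt only orthogonalises; \<open>s j\<close> is the norm of column
    j, by which it is divided below.\<close>
  define s where "s j = sqrt (\<Sum>k<n. (cmod (W $$ (k,j)))\<^sup>2)" for j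
  have s2: "complex_of_real (s j) * complex_of_real (s j) = (\<Sum>k<n. W $$ (k,j) * cnj (W $$ (k,j)))" for j
    by (simp add: s_def sum_nonneg flip: of_real_mult complex_norm_square)
  have s0: "s j \<noteq> 0" if "j < n" for j
    using ip[OF that that] s2[of j] by auto
  define U where "U = mat n n (\<lambda>(i,j). W $$ (i,j) / s j)"
  have U: "U \<in> carrier_mat n n" unfolding U_def by auto
  have "adj U * U = 1\<^sub>m n"
  proof (rule eq_matI)
    fix i j assume "i < dim_row (1\<^sub>m n :: complex mat)" "j < dim_col (1\<^sub>m n :: complex mat)"
    then have ij: "i < n" "j < n" by auto
    have "(adj U * U) $$ (i,j) = (\<Sum>k<n. cnj (W $$ (k,i) / s i) * (W $$ (k,j) / s j))"
      using ij by (subst index_mult_sum[OF adj_carrier[OF U] U]) (auto simp: U_def)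
    also have "\<dots> = (\<Sum>k<n. W $$ (k,j) * cnj (W $$ (k,i))) / (s i * s j)"
      by (simp add: sum_divide_distrib mult.commute)
    also have "\<dots> = 1\<^sub>m n $$ (i,j)"
      using ij ip[OF ij(2,1)] s2[of i] s0[of i] by auto
    finally show "(adj U * U) $$ (i,j) = 1\<^sub>m n $$ (i,j)" .
  qed (use U in auto)
  then have uU: "unitary U" by (rule unitaryI[OF U])
  have W0: "W $$ (k,0) = v $ k" if "k < n" for k
    using that hdws n len unfolding W_def
    by (cases ws) (auto simp: mat_of_cols_index)
  have "(A * U) $$ (i,0) = e * U $$ (i,0)" if i: "i < n" for i
  proof -
    have "(A * U) $$ (i,0) = (\<Sum>k<n. A $$ (i,k) * v $ k) / s 0"
      using i n by (subst index_mult_sum[OF A U]) (auto simp: U_def W0 sum_divide_distrib)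
    also have "(\<Sum>k<n. A $$ (i,k) * v $ k) = (A *\<^sub>v v) $ i"
      using i A v by (auto simp: scalar_prod_def atLeast0LessThan)
    finally show ?thesis using i n v by (simp add: Av U_def W0)
  qed
  with U uU show ?thesis using that by blast
qed

lemma adj_four_block_diag:
  assumes "A \<in> carrier_mat n n" "B \<in> carrier_mat m m"
  shows "adj (four_block_mat A (0\<^sub>m n m) (0\<^sub>m m n) B) = four_block_mat (adj A) (0\<^sub>m n m) (0\<^sub>m m n) (adj B)"
  by (rule eq_matI) (use assms in auto)

lemma mult_four_block_diag:
  assumes "A \<in> carrier_mat n n" "B \<in> carrier_mat m m" "C \<in> carrier_mat n n" "D \<in> carrier_mat m m"
  shows "four_block_mat A (0\<^sub>m n m) (0\<^sub>m m n) B * four_block_mat C (0\<^sub>m n m) (0\<^sub>m m n) D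
    = four_block_mat (A * C) (0\<^sub>m n m) (0\<^sub>m m n) (B * D)"
  using assms by (subst mult_four_block_mat[where ?nr1.0=n and ?n1.0=n and ?nr2.0=m and ?n2.0=m and ?nc1.0=n and ?nc2.0=m]) auto

text \<open>Induction on the dimension. In a unitary basis starting with an eigenvector, the first
  column of the matrix is (e, 0, ..., 0); by hermiticity so is the first row up to conjugation. The
  matrix is then block diagonal, and the remaining block is Hermitian of size n.\<close>

lemma spectral_theorem:
  assumes "A \<in> carrier_mat n n" "hermitian A"
  shows "\<exists>U lam. U \<in> carrier_mat n n \<and> unitary U \<and> A = U * real_diag n lam * adj U"
  using assms
proof (induction n arbitrary: A)
  case 0
  then show ?case
    by (intro exI[of _ "1\<^sub>m 0"]) (auto intro!: eq_matI simp: unitary_def)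
next
  case (Suc n)
  note A = Suc.prems(1)
  obtain U e where U: "U \<in> carrier_mat (Suc n) (Suc n)" and uU: "unitary U"
    and ev: "\<And>i. i < Suc n \<Longrightarrow> (A * U) $$ (i,0) = e * U $$ (i,0)"
    using unit_eigenvector_completion[OF A] by auto
  note UU = unitaryD[OF uU U]
  define B where "B = adj U * A * U"
  have B: "B \<in> carrier_mat (Suc n) (Suc n)" unfolding B_def using A U by auto
  have hA: "adj A = A" using Suc.prems unfolding hermitian_def by auto
  have hB: "adj B = B"
    unfolding B_def using A U hA
    by (simp add: adj_mult[of _ "Suc n" "Suc n" _ "Suc n"] assoc_mult_square[of _ "Suc n"])
  have Bh: "B $$ (i,j) = cnj (B $$ (j,i))" if "i < Suc n" "j < Suc n" for i j
    using that B by (subst hB[symmetric]) auto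
  \<comment> \<open>Column 0 of \<open>A * U\<close> is e times column 0 of \<open>U\<close>, so
    column 0 of \<open>B\<close> is e times column 0 of \<open>adj U * U\<close>.\<close>
  have B0: "B $$ (i,0) = (if i = 0 then e else 0)" if i: "i < Suc n" for i
  proof -
    have "B = adj U * (A * U)" unfolding B_def using A U by (simp add: assoc_mult_square[of _ "Suc n"])
    then have "B $$ (i,0) = (\<Sum>k<Suc n. adj U $$ (i,k) * (A * U) $$ (k,0))"
      using i A U by (simp only: index_mult_sum[of "adj U" "Suc n" "Suc n" "A * U" "Suc n"] adj_carrier mult_carrier_mat)
    also have "\<dots> = e * (\<Sum>k<Suc n. adj U $$ (i,k) * U $$ (k,0))"
      unfolding sum_distrib_left by (rule sum.cong) (auto simp: ev simp del: index_mult_mat)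
    also have "(\<Sum>k<Suc n. adj U $$ (i,k) * U $$ (k,0)) = (adj U * U) $$ (i,0)"
      using i U by (simp only: index_mult_sum[of "adj U" "Suc n" "Suc n" "U" "Suc n"] adj_carrier)
    finally show ?thesis using i by (simp add: UU)
  qed
  \<comment> \<open>The eigenvalue is a diagonal entry of a Hermitian matrix, hence real, as
    \<open>real_diag\<close> demands.\<close>
  have cnj_e: "cnj e = e"
    using B0[of 0] Bh[of 0 0] by simp
  then have ereal: "e = complex_of_real (Re e)"
    by (simp add: complex_eq_iff)
  define C where "C = mat n n (\<lambda>(i,j). B $$ (Suc i, Suc j))"
  have C: "C \<in> carrier_mat n n" unfolding C_def by auto
  have "adj C = C"
    by (rule eq_matI) (auto simp: C_def Bh[symmetric])
  then have "hermitian C" using C unfolding hermitian_def by auto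
  from Suc.IH[OF C this] obtain V lam where V: "V \<in> carrier_mat n n" and uV: "unitary V"
    and CV: "C = V * real_diag n lam * adj V" by auto
  note VV = unitaryD[OF uV V]
  let ?E = "mat 1 1 (\<lambda>_. e)"
  let ?blk = "\<lambda>X Y. four_block_mat X (0\<^sub>m 1 n) (0\<^sub>m n 1) Y :: complex mat"
  let ?lam = "case_nat (Re e) lam"
  have BC: "B = ?blk ?E C"
    by (rule eq_matI) (use B B0 Bh[of 0] cnj_e in \<open>auto simp: C_def\<close>)
  have D: "real_diag (Suc n) ?lam = ?blk ?E (real_diag n lam)"
    using ereal by (intro eq_matI) (auto split: nat.splits)
  let ?V = "?blk (1\<^sub>m 1) V"
  have V': "?V \<in> carrier_mat (Suc n) (Suc n)" using V by auto
  have "adj ?V * ?V = 1\<^sub>m (Suc n)"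
    using V VV by (simp add: adj_four_block_diag mult_four_block_diag)
  then have uV': "unitary ?V" by (rule unitaryI[OF V'])
  have BV: "B = ?V * real_diag (Suc n) ?lam * adj ?V"
    unfolding D BC CV using V
    by (simp add: adj_four_block_diag mult_four_block_diag)
  have "A = (U * adj U) * A * (U * adj U)" using A UU by simp
  also have "\<dots> = U * B * adj U"
    unfolding B_def using A U
    by (simp add: assoc_mult_square[of _ "Suc n"])
  also have "\<dots> = (U * ?V) * real_diag (Suc n) ?lam * adj (U * ?V)"
    unfolding BV adj_mult[OF U V'] using U V' 
    by (simp add: assoc_mult_square[of _ "Suc n"])
  finally have "A = (U * ?V) * real_diag (Suc n) ?lam * adj (U * ?V)" .
  moreover have "unitary (U * ?V)" by (rule unitary_mult[OF uU uV' U V'])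
  ultimately show ?case using U V' by (metis mult_carrier_mat)
qed

section \<open>Well-definedness of functions of a Hermitian matrix\<close>

lemma mult_real_diag_index:
  assumes "W \<in> carrier_mat n n" "i < n" "j < n"
  shows "(W * real_diag n lam) $$ (i,j) = W $$ (i,j) * lam j"
    "(real_diag n lam * W) $$ (i,j) = lam i * W $$ (i,j)"
  using assms by (auto simp: index_mult_sum[of _ n n _ n] if_distrib[where f="\<lambda>x. x * _"] if_distrib[where f="\<lambda>x. _ * x"] sum.delta sum.delta'
      simp del: index_mult_mat cong: if_cong)

text \<open>The change of basis \<open>W = adj V * U\<close> intertwines the two diagonal matrices,
  so its entry (i,j) vanishes unless lam j = mu i. Where lam j = mu i, also f (lam j) = f (mu i), so
  \<open>W\<close> intertwines the images under f as well.\<close>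

lemma diagonalisation_fun_unique:
  assumes U: "U \<in> carrier_mat n n" "unitary U" and V: "V \<in> carrier_mat n n" "unitary V"
    and eq: "U * real_diag n lam * adj U = V * real_diag n mu * adj V"
  shows "U * real_diag n (f \<circ> lam) * adj U = V * real_diag n (f \<circ> mu) * adj V"
proof -
  define W where "W = adj V * U"
  have W: "W \<in> carrier_mat n n" using U V unfolding W_def by auto
  note UU = unitaryD[OF U(2,1)] and VV = unitaryD[OF V(2,1)]
  note assoc = assoc_mult_square[of _ n]
  have cancel: "X * (adj U * U) = X" "(adj V * V) * X = X" "X * (U * adj U) = X" "(V * adj V) * X = X"
    if "X \<in> carrier_mat n n" for X
    using that by (auto simp: UU VV)
  have "W * real_diag n lam = adj V * (U * real_diag n lam * adj U) * U"
    using cancel(1)[of "W * real_diag n lam"] U V unfolding W_def by (simp add: assoc)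
  also have "\<dots> = real_diag n mu * W"
    unfolding eq using cancel(2)[of "real_diag n mu * W"] U V unfolding W_def by (simp add: assoc)
  finally have "W $$ (i,j) * lam j = mu i * W $$ (i,j)" if "i < n" "j < n" for i j
    using mult_real_diag_index[OF W that] by metis
  then have "W $$ (i,j) = 0 \<or> lam j = mu i" if "i < n" "j < n" for i j
    using that by (metis mult.commute mult_cancel_left of_real_eq_iff)
  then have "W * real_diag n (f \<circ> lam) = real_diag n (f \<circ> mu) * W"
    using W by (intro eq_matI) (auto simp: mult_real_diag_index simp del: index_mult_mat(1), metis)
  then have "V * (W * real_diag n (f \<circ> lam)) * adj U = V * (real_diag n (f \<circ> mu) * W) * adj U"
    by simp
  moreover have "V * (W * real_diag n (f \<circ> lam)) * adj U = U * real_diag n (f \<circ> lam) * adj U"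
    using cancel(4)[of "U * real_diag n (f \<circ> lam) * adj U"] U V unfolding W_def by (simp add: assoc)
  moreover have "V * (real_diag n (f \<circ> mu) * W) * adj U = V * real_diag n (f \<circ> mu) * adj V"
    using cancel(3)[of "V * real_diag n (f \<circ> mu) * adj V"] U V unfolding W_def by (simp add: assoc)
  ultimately show ?thesis by simp
qed

text \<open>Removes the choice operator in \<open>mat_fun\<close>: any diagonalisation at hand may
  be used to compute it.\<close>

lemma mat_fun_eq:
  assumes U: "U \<in> carrier_mat n n" "unitary U" and A: "A = U * real_diag n lam * adj U"
  shows "mat_fun f A = U * real_diag n (f \<circ> lam) * adj U"
proof -
  have dim: "dim_row A = n" using U A by auto
  show ?thesis unfolding mat_fun_def dim
  proof (rule some_equality)
    show "\<exists>U' lam'. unitary U' \<and> dim_row U' = n \<and> A = U' * real_diag n lam' * adj U' \<and>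
      U * real_diag n (f \<circ> lam) * adj U = U' * real_diag n (f \<circ> lam') * adj U'"
      using U A by (intro exI[of _ U] exI[of _ lam]) auto
  next
    fix B assume "\<exists>V mu. unitary V \<and> dim_row V = n \<and> A = V * real_diag n mu * adj V \<and>
      B = V * real_diag n (f \<circ> mu) * adj V"
    then obtain V mu where V: "unitary V" "dim_row V = n"
      and AV: "A = V * real_diag n mu * adj V" "B = V * real_diag n (f \<circ> mu) * adj V" by auto
    have "V \<in> carrier_mat n n" using V unfolding unitary_def by auto
    then show "B = U * real_diag n (f \<circ> lam) * adj U"
      unfolding AV by (intro diagonalisation_fun_unique) (use U A V AV in auto)
  qed
qed

section \<open>Traces in terms of eigenvalues and overlaps\<close>

lemma mtrace_comm:
  assumes "A \<in> carrier_mat n m" "B \<in> carrier_mat m n"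
  shows "mtrace (A * B) = mtrace (B * A)"
proof -
  have "mtrace (A * B) = (\<Sum>i<n. \<Sum>l<m. A $$ (i,l) * B $$ (l,i))"
    unfolding mtrace_def using assms
    by (auto simp: index_mult_sum[OF assms] simp del: index_mult_mat(1) intro!: sum.cong)
  also have "\<dots> = (\<Sum>l<m. \<Sum>i<n. B $$ (l,i) * A $$ (i,l))"
    by (subst sum.swap) (simp add: mult.commute)
  also have "\<dots> = mtrace (B * A)"
    unfolding mtrace_def using assms
    by (auto simp: index_mult_sum[OF assms(2,1)] simp del: index_mult_mat(1) intro!: sum.cong)
  finally show ?thesis .
qed

text \<open>The entry of \<open>adj U * V\<close> is the inner product of column i of
  \<open>U\<close> with column j of \<open>V\<close>, so this is a transition probability between
  basis vectors.\<close>

definition overlap :: "complex mat \<Rightarrow> complex mat \<Rightarrow> nat \<Rightarrow> nat \<Rightarrow> real" where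
  "overlap U V i j = (cmod ((adj U * V) $$ (i,j)))\<^sup>2"

lemma overlap_nonneg: "0 \<le> overlap U V i j"
  unfolding overlap_def by simp

lemma of_real_overlap:
  "complex_of_real (overlap U V i j) = (adj U * V) $$ (i,j) * cnj ((adj U * V) $$ (i,j))"
  unfolding overlap_def by (rule complex_norm_square)

text \<open>\<open>adj U * V\<close> is unitary, so its rows and columns are unit vectors.\<close>

lemma sum_overlap:
  assumes U: "U \<in> carrier_mat n n" "unitary U" and V: "V \<in> carrier_mat n n" "unitary V"
  shows "i < n \<Longrightarrow> (\<Sum>j<n. overlap U V i j) = 1"
    "j < n \<Longrightarrow> (\<Sum>i<n. overlap U V i j) = 1"
proof -
  define W where "W = adj U * V"
  have W: "W \<in> carrier_mat n n" using U V unfolding W_def by auto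
  have "unitary W" unfolding W_def
    by (rule unitary_mult[of _ _ n]) (use U V unitary_adj in auto)
  note WW = unitaryD[OF this W]
  {
    assume i: "i < n"
    have "complex_of_real (\<Sum>j<n. overlap U V i j) = (\<Sum>j<n. W $$ (i,j) * adj W $$ (j,i))"
      using W i by (simp add: of_real_overlap flip: W_def)
    also have "\<dots> = (W * adj W) $$ (i,i)"
      using W i by (subst index_mult_sum[of _ n n _ n]) auto
    finally show "(\<Sum>j<n. overlap U V i j) = 1" using i by (simp add: WW flip: of_real_sum)
  next
    assume j: "j < n"
    have "complex_of_real (\<Sum>i<n. overlap U V i j) = (\<Sum>i<n. adj W $$ (j,i) * W $$ (i,j))"
      using W j by (simp add: of_real_overlap mult.commute flip: W_def)
    also have "\<dots> = (adj W * W) $$ (j,j)"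
      using W j by (subst index_mult_sum[of _ n n _ n]) auto
    finally show "(\<Sum>i<n. overlap U V i j) = 1" using j by (simp add: WW flip: of_real_sum)
  }
qed

text \<open>Cyclicity of the trace leaves only the change of basis \<open>W = adj U * V\<close>
  between the two diagonal matrices. This is the bridge from traces of noncommuting matrices to
  classical double sums.\<close>

lemma mtrace_diagonalised_mult:
  assumes U: "U \<in> carrier_mat n n" and V: "V \<in> carrier_mat n n"
  shows "mtrace ((U * real_diag n f * adj U) * (V * real_diag n g * adj V))
    = complex_of_real (\<Sum>i<n. \<Sum>j<n. overlap U V i j * (f i * g j))"
proof -
  define W where "W = adj U * V"
  have W: "W \<in> carrier_mat n n" using U V unfolding W_def by auto
  note assoc = assoc_mult_square[of _ n]
  have aW: "adj W = adj V * U" unfolding W_def using U V by (simp add: adj_mult[of _ n n _ n])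
  have "mtrace ((U * real_diag n f * adj U) * (V * real_diag n g * adj V))
      = mtrace (U * (real_diag n f * (W * (real_diag n g * adj V))))"
    unfolding W_def using U V by (simp add: assoc)
  also have "\<dots> = mtrace ((real_diag n f * (W * (real_diag n g * adj V))) * U)"
    by (rule mtrace_comm[of _ n n]) (use U V W in auto)
  also have "\<dots> = mtrace (real_diag n f * (W * real_diag n g * adj W))"
    unfolding aW using U V W by (simp add: assoc)
  also have "\<dots> = (\<Sum>i<n. f i * (\<Sum>j<n. W $$ (i,j) * g j * cnj (W $$ (i,j))))"
  proof -
    have "(W * real_diag n g * adj W) $$ (i,i) = (\<Sum>j<n. W $$ (i,j) * g j * cnj (W $$ (i,j)))"
      if "i < n" for i
      using that W
      by (subst index_mult_sum[of _ n n _ n])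
        (auto simp: mult_real_diag_index simp del: index_mult_mat(1) intro!: sum.cong)
    then show ?thesis unfolding mtrace_def using W
      by (auto simp: mult_real_diag_index(2)[of _ n] simp del: index_mult_mat(1) intro!: sum.cong)
  qed
  also have "\<dots> = complex_of_real (\<Sum>i<n. \<Sum>j<n. overlap U V i j * (f i * g j))"
    by (simp add: sum_distrib_left of_real_overlap mult_ac flip: W_def)
  finally show ?thesis .
qed

lemma overlap_self:
  assumes "U \<in> carrier_mat n n" "unitary U" "i < n" "j < n"
  shows "overlap U U i j = (if i = j then 1 else 0)"
  using unitaryD[OF assms(2,1)] assms by (simp add: overlap_def del: index_mult_mat(1))

lemma mtrace_diagonalised:
  assumes U: "U \<in> carrier_mat n n" "unitary U"
  shows "mtrace (U * real_diag n f * adj U) = complex_of_real (\<Sum>i<n. f i)"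
proof -
  have "mtrace (U * real_diag n f * adj U) = mtrace (adj U * (U * real_diag n f))"
    by (rule mtrace_comm[of _ n n]) (use U in auto)
  also have "adj U * (U * real_diag n f) = (adj U * U) * real_diag n f"
    using U by (simp add: assoc_mult_square[of _ n])
  also have "\<dots> = real_diag n f" using U by (simp add: unitaryD)
  finally show ?thesis by (simp add: mtrace_def)
qed

text \<open>The quadratic form evaluated at column i of \<open>U\<close>, a unit eigenvector, is
  exactly lam i.\<close>

lemma psd_eigenvalue_nonneg:
  assumes U: "U \<in> carrier_mat n n" "unitary U" and psd: "psd (U * real_diag n lam * adj U)"
    and i: "i < n"
  shows "0 \<le> lam i"
proof -
  let ?A = "U * real_diag n lam * adj U"
  have A: "?A \<in> carrier_mat n n" using U by auto
  have v: "dim_vec (col U i) = dim_row ?A" using U by auto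
  have "adj U * (?A * U) = (adj U * U) * real_diag n lam * (adj U * U)"
    using U by (simp add: assoc_mult_square[of _ n])
  also have "\<dots> = real_diag n lam" by (simp add: unitaryD[OF U(2,1)])
  finally have "complex_of_real (lam i) = (adj U * (?A * U)) $$ (i,i)" using i by simp
  also have "\<dots> = (\<Sum>k<n. cnj (col U i $ k) * ((?A *\<^sub>v col U i) $ k))"
    using U i A by (subst index_mult_sum[of _ n n _ n]) (auto intro!: sum.cong)
  finally have *: "complex_of_real (lam i) = (\<Sum>k<dim_row ?A. cnj (col U i $ k) * ((?A *\<^sub>v col U i) $ k))"
    unfolding carrier_matD(1)[OF A] .
  have "0 \<le> Re (\<Sum>k<dim_row ?A. cnj (col U i $ k) * ((?A *\<^sub>v col U i) $ k))"
    using psd v unfolding psd_def by blast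
  then show ?thesis unfolding *[symmetric] by simp
qed

section \<open>Kronecker products and partial traces\<close>

lemma sum_lessThan_mult:
  fixes f :: "nat \<Rightarrow> 'a::comm_monoid_add"
  shows "(\<Sum>l<n*m. f l) = (\<Sum>a<n. \<Sum>b<m. f (a * m + b))"
proof -
  have "(\<Sum>b<m. f (a * m + b)) = (\<Sum>l\<in>{a*m..<a*m+m}. f l)" for a
    using sum.shift_bounds_nat_ivl[of f 0 "a*m" m] by (simp add: atLeast0LessThan add.commute)
  then show ?thesis by (simp add: sum.nat_group)
qed

lemma div_mod_less:
  fixes i n m :: nat
  assumes "i < n * m"
  shows "i div m < n" "i mod m < m"
  using assms by (auto simp: less_mult_imp_div_less) (cases m; simp)

lemma mult_add_less: "a < n \<Longrightarrow> b < m \<Longrightarrow> a * m + b < n * (m::nat)"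
  by (metis add.commute add_less_cancel_left less_le_trans mult_Suc mult_le_mono1 Suc_leI)

lemma kron_carrier [simp]:
  "A \<in> carrier_mat n n \<Longrightarrow> B \<in> carrier_mat m m \<Longrightarrow> kron A B \<in> carrier_mat (n * m) (n * m)"
  unfolding kron_def by auto

lemma dim_kron [simp]:
  "dim_row (kron A B) = dim_row A * dim_row B" "dim_col (kron A B) = dim_col A * dim_col B"
  unfolding kron_def by auto

lemma index_kron:
  assumes "A \<in> carrier_mat n n" "B \<in> carrier_mat m m" "i < n * m" "j < n * m"
  shows "kron A B $$ (i,j) = A $$ (i div m, j div m) * B $$ (i mod m, j mod m)"
  using assms unfolding kron_def by auto

lemma adj_kron:
  assumes "A \<in> carrier_mat n n" "B \<in> carrier_mat m m"
  shows "adj (kron A B) = kron (adj A) (adj B)"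
  using assms
  by (intro eq_matI) (auto simp: index_kron[of _ n _ m] div_mod_less)

lemma mult_kron:
  assumes A: "A \<in> carrier_mat n n" and B: "B \<in> carrier_mat m m"
    and C: "C \<in> carrier_mat n n" and D: "D \<in> carrier_mat m m"
  shows "kron A B * kron C D = kron (A * C) (B * D)"
proof (rule eq_matI)
  note AB = kron_carrier[OF A B] and CD = kron_carrier[OF C D]
  note ACBD = kron_carrier[OF mult_carrier_mat[OF A C] mult_carrier_mat[OF B D]]
  show "dim_row (kron A B * kron C D) = dim_row (kron (A * C) (B * D))"
    "dim_col (kron A B * kron C D) = dim_col (kron (A * C) (B * D))"
    using AB CD ACBD by auto
  fix i j assume "i < dim_row (kron (A * C) (B * D))" "j < dim_col (kron (A * C) (B * D))"
  then have ij: "i < n * m" "j < n * m" using ACBD by auto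
  note dm = div_mod_less[OF ij(1)] div_mod_less[OF ij(2)]
  have "(kron A B * kron C D) $$ (i,j)
      = (\<Sum>a<n. \<Sum>b<m. kron A B $$ (i,a*m+b) * kron C D $$ (a*m+b,j))"
    using ij by (simp add: index_mult_sum[OF AB CD] sum_lessThan_mult del: index_mult_mat(1))
  also have "\<dots> = (\<Sum>a<n. \<Sum>b<m. A $$ (i div m, a) * B $$ (i mod m, b) * (C $$ (a, j div m) * D $$ (b, j mod m)))"
    using ij by (intro sum.cong refl) (simp add: mult_add_less index_kron[OF A B] index_kron[OF C D])
  also have "\<dots> = (\<Sum>a<n. \<Sum>b<m. (A $$ (i div m, a) * C $$ (a, j div m)) * (B $$ (i mod m, b) * D $$ (b, j mod m)))"
    by (intro sum.cong refl) simp
  also have "\<dots> = (A * C) $$ (i div m, j div m) * (B * D) $$ (i mod m, j mod m)"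
    using dm by (simp add: index_mult_sum[OF A C] index_mult_sum[OF B D] sum_product del: index_mult_mat(1))
  also have "\<dots> = kron (A * C) (B * D) $$ (i,j)"
    using ij A B C D by (subst index_kron[of _ n _ m]) auto
  finally show "(kron A B * kron C D) $$ (i,j) = kron (A * C) (B * D) $$ (i,j)" .
qed

lemma kron_real_diag:
  "kron (real_diag n a) (real_diag m b) = real_diag (n * m) (\<lambda>i. a (i div m) * b (i mod m))"
proof (rule eq_matI)
  fix i j assume "i < dim_row (real_diag (n * m) (\<lambda>i. a (i div m) * b (i mod m)))"
    "j < dim_col (real_diag (n * m) (\<lambda>i. a (i div m) * b (i mod m)))"
  then have ij: "i < n * m" "j < n * m" by auto
  have "i = j \<longleftrightarrow> i div m = j div m \<and> i mod m = j mod m"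
    by (metis div_mult_mod_eq)
  then show "kron (real_diag n a) (real_diag m b) $$ (i,j)
      = real_diag (n * m) (\<lambda>i. a (i div m) * b (i mod m)) $$ (i,j)"
    using ij by (simp add: index_kron[of _ n _ m] div_mod_less)
qed (auto simp: kron_def)

lemma one_real_diag: "1\<^sub>m n = real_diag n (\<lambda>_. 1)"
  by (rule eq_matI) auto

lemma kron_one: "kron (1\<^sub>m n) (1\<^sub>m m) = 1\<^sub>m (n * m)"
  unfolding one_real_diag kron_real_diag by simp

lemma unitary_kron:
  assumes "V \<in> carrier_mat n n" "unitary V" "X \<in> carrier_mat m m" "unitary X"
  shows "unitary (kron V X)"
  by (rule unitaryI[of _ "n * m"])
    (use assms in \<open>simp_all add: adj_kron[of _ n _ m] mult_kron[of _ n _ m] unitaryD kron_one\<close>)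

lemma kron_diagonalised:
  assumes "V \<in> carrier_mat n n" "X \<in> carrier_mat m m"
  shows "kron (V * real_diag n a * adj V) (X * real_diag m b * adj X)
    = kron V X * real_diag (n * m) (\<lambda>i. a (i div m) * b (i mod m)) * adj (kron V X)"
  using assms by (simp add: adj_kron[of _ n _ m] mult_kron[of _ n _ m] flip: kron_real_diag)

section \<open>Partial traces\<close>

lemma ptrace_carrier [simp]: "ptrace_A d \<rho> \<in> carrier_mat d d" "ptrace_B d \<rho> \<in> carrier_mat d d"
  unfolding ptrace_A_def ptrace_B_def by auto

lemma dim_ptrace [simp]:
  "dim_row (ptrace_A d \<rho>) = d" "dim_col (ptrace_A d \<rho>) = d"
  "dim_row (ptrace_B d \<rho>) = d" "dim_col (ptrace_B d \<rho>) = d"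
  unfolding ptrace_A_def ptrace_B_def by auto

lemma index_ptrace:
  assumes "i < d" "j < d"
  shows "ptrace_A d \<rho> $$ (i,j) = (\<Sum>k<d. \<rho> $$ (k*d+i, k*d+j))"
    "ptrace_B d \<rho> $$ (i,j) = (\<Sum>k<d. \<rho> $$ (i*d+k, j*d+k))"
  using assms unfolding ptrace_A_def ptrace_B_def by auto

lemma hermitian_ptrace:
  assumes \<rho>: "\<rho> \<in> carrier_mat (d * d) (d * d)" and h: "hermitian \<rho>"
  shows "hermitian (ptrace_A d \<rho>)" "hermitian (ptrace_B d \<rho>)"
proof -
  have hc: "cnj (\<rho> $$ (j,i)) = \<rho> $$ (i,j)" if "i < d * d" "j < d * d" for i j
    using h that \<rho> unfolding hermitian_def by (metis index_adj carrier_matD)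
  show "hermitian (ptrace_A d \<rho>)" "hermitian (ptrace_B d \<rho>)"
    unfolding hermitian_def
    by (auto intro!: eq_matI sum.cong simp: ptrace_A_def ptrace_B_def hc mult_add_less)
qed

lemma mtrace_mult_kron:
  assumes \<rho>: "\<rho> \<in> carrier_mat (d * d) (d * d)" and Y: "Y \<in> carrier_mat d d" and Z: "Z \<in> carrier_mat d d"
  shows "mtrace (\<rho> * kron Y Z) = (\<Sum>a<d. \<Sum>b<d. \<Sum>a'<d. \<Sum>b'<d.
    \<rho> $$ (a*d+b, a'*d+b') * (Y $$ (a',a) * Z $$ (b',b)))"
  unfolding mtrace_def using \<rho> kron_carrier[OF Y Z]
  by (auto simp: index_mult_sum[OF \<rho> kron_carrier[OF Y Z]] sum_lessThan_mult index_kron[OF Y Z] mult_add_less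
      simp del: index_mult_mat(1) intro!: sum.cong)

text \<open>The duality that characterises the partial trace: an observable on one factor sees only
  the reduced state there. \<open>ptrace_B\<close> sums out the second factor, so it pairs with
  observables on the first, and \<open>ptrace_A\<close> the other way round.\<close>

lemma mtrace_mult_kron_one:
  assumes \<rho>: "\<rho> \<in> carrier_mat (d * d) (d * d)" and Y: "Y \<in> carrier_mat d d"
  shows "mtrace (\<rho> * kron Y (1\<^sub>m d)) = mtrace (ptrace_B d \<rho> * Y)"
    "mtrace (\<rho> * kron (1\<^sub>m d) Y) = mtrace (ptrace_A d \<rho> * Y)"
proof -
  have "mtrace (\<rho> * kron Y (1\<^sub>m d)) = (\<Sum>a<d. \<Sum>b<d. \<Sum>a'<d. \<rho> $$ (a*d+b, a'*d+b) * Y $$ (a',a))"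
    unfolding mtrace_mult_kron[OF \<rho> Y one_carrier_mat]
    by (auto simp: if_distrib sum.delta cong: if_cong intro!: sum.cong)
  also have "\<dots> = (\<Sum>a<d. \<Sum>a'<d. (\<Sum>b<d. \<rho> $$ (a*d+b, a'*d+b)) * Y $$ (a',a))"
    unfolding sum_distrib_right by (rule sum.cong[OF refl], rule sum.swap)
  also have "\<dots> = mtrace (ptrace_B d \<rho> * Y)"
    unfolding mtrace_def using Y
    by (simp add: index_mult_sum[OF ptrace_carrier(2) Y] index_ptrace del: index_mult_mat(1))
  finally show "mtrace (\<rho> * kron Y (1\<^sub>m d)) = mtrace (ptrace_B d \<rho> * Y)" .
  have "mtrace (\<rho> * kron (1\<^sub>m d) Y) = (\<Sum>a<d. \<Sum>b<d. \<Sum>a'<d. \<Sum>b'<d.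
      if a' = a then \<rho> $$ (a*d+b, a*d+b') * Y $$ (b',b) else 0)"
    unfolding mtrace_mult_kron[OF \<rho> one_carrier_mat Y]
    by (auto intro!: sum.cong)
  also have "\<dots> = (\<Sum>a<d. \<Sum>b<d. \<Sum>b'<d. \<rho> $$ (a*d+b, a*d+b') * Y $$ (b',b))"
  proof (rule sum.cong[OF refl], rule sum.cong[OF refl])
    fix a b assume "a \<in> {..<d}"
    then show "(\<Sum>a'<d. \<Sum>b'<d. if a' = a then \<rho> $$ (a*d+b, a*d+b') * Y $$ (b',b) else 0)
        = (\<Sum>b'<d. \<rho> $$ (a*d+b, a*d+b') * Y $$ (b',b))"
      by (subst sum.swap) (simp add: sum.delta)
  qed
  also have "\<dots> = (\<Sum>b<d. \<Sum>a<d. \<Sum>b'<d. \<rho> $$ (a*d+b, a*d+b') * Y $$ (b',b))"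
    by (rule sum.swap)
  also have "\<dots> = (\<Sum>b<d. \<Sum>b'<d. (\<Sum>a<d. \<rho> $$ (a*d+b, a*d+b')) * Y $$ (b',b))"
    unfolding sum_distrib_right by (rule sum.cong[OF refl], rule sum.swap)
  also have "\<dots> = mtrace (ptrace_A d \<rho> * Y)"
    unfolding mtrace_def using Y
    by (simp add: index_mult_sum[OF ptrace_carrier(1) Y] index_ptrace del: index_mult_mat(1))
  finally show "mtrace (\<rho> * kron (1\<^sub>m d) Y) = mtrace (ptrace_A d \<rho> * Y)" .
qed

section \<open>The classical inequality\<close>

text \<open>Dividing by q and setting s = sqrt (p / q) leaves an inequality in s alone. The term p -
  q carries the first order behaviour at p = q, which no multiple of a square could bound; it
  cancels once summed over two probability distributions.\<close>

lemma mult_ln_ratio_le: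
  fixes p q R :: real
  assumes p: "0 < p" and q: "0 < q" and le: "p \<le> R * q" and R: "1 \<le> R"
  shows "p * (ln p - ln q) \<le> (p - q) + (5 + 4 * ln R) * (sqrt p - sqrt q)\<^sup>2"
proof -
  define s where "s = sqrt p / sqrt q"
  have s: "s > 0" using p q unfolding s_def by simp
  have ps: "p = s\<^sup>2 * q" "sqrt p = s * sqrt q" using p q unfolding s_def by (auto simp: field_simps)
  have lns: "ln p - ln q = 2 * ln s"
    using p q s by (simp add: ps(1) ln_mult ln_realpow)
  have "2 * ln s \<le> ln R"
  proof -
    have "p / q \<le> R" using le q by (simp add: field_simps)
    then have "ln (p / q) \<le> ln R" using p q R by simp
    then show ?thesis using lns p q by (simp add: ln_div)
  qed
  have lnR: "0 \<le> ln R" using R by simp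
  have "2 * s\<^sup>2 * ln s \<le> s\<^sup>2 - 1 + (5 + 4 * ln R) * (s - 1)\<^sup>2"
  proof (cases "s \<le> 2")
    case True
    have "2 * s\<^sup>2 * ln s \<le> 2 * s\<^sup>2 * (s - 1)"
      using s by (intro mult_left_mono ln_le_minus_one) auto
    \<comment> \<open>Subtracting s^2 - 1 leaves a double zero at s = 1. The cofactor 2 * s + 1 is
      at most 5 for s up to 2, whence the constant 5.\<close>
    also have "\<dots> = s\<^sup>2 - 1 + (2 * s + 1) * (s - 1)\<^sup>2"
      by (simp add: power2_eq_square algebra_simps)
    also have "\<dots> \<le> s\<^sup>2 - 1 + (5 + 4 * ln R) * (s - 1)\<^sup>2"
      using True lnR by (intro add_left_mono mult_right_mono) auto
    finally show ?thesis .
  next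
    case False
    \<comment> \<open>For s > 2 one has s < 2 * (s - 1); the square of this 2 is the 4 in front of
      ln R.\<close>
    have "s\<^sup>2 \<le> (2 * (s - 1))\<^sup>2"
      using False by (intro power_mono) auto
    then have "s\<^sup>2 * (2 * ln s) \<le> (2 * (s - 1))\<^sup>2 * ln R"
      using False \<open>2 * ln s \<le> ln R\<close> by (intro mult_mono) auto
    also have "\<dots> = 4 * ln R * (s - 1)\<^sup>2" by (simp add: power2_eq_square algebra_simps)
    also have "\<dots> \<le> s\<^sup>2 - 1 + (5 + 4 * ln R) * (s - 1)\<^sup>2"
    proof -
      have "1 \<le> s\<^sup>2" using False by (intro one_le_power) auto
      then have "0 \<le> s\<^sup>2 - 1 + 5 * (s - 1)\<^sup>2" by simp
      then show ?thesis by (simp add: distrib_right)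
    qed
    finally show ?thesis by (simp add: mult_ac)
  qed
  then have "q * (2 * s\<^sup>2 * ln s) \<le> q * (s\<^sup>2 - 1 + (5 + 4 * ln R) * (s - 1)\<^sup>2)"
    using q by (intro mult_left_mono) auto
  moreover have "p * (ln p - ln q) = q * (2 * s\<^sup>2 * ln s)"
    unfolding lns by (subst ps(1)) simp
  moreover have "(sqrt p - sqrt q)\<^sup>2 = q * (s - 1)\<^sup>2"
  proof -
    have "sqrt p - sqrt q = sqrt q * (s - 1)" using ps(2) by (simp add: algebra_simps)
    then show ?thesis using q by (simp add: power_mult_distrib)
  qed
  ultimately show ?thesis by (simp add: ps(1) algebra_simps)
qed

text \<open>The scalar function that \<open>mln\<close> applies to the eigenvalues, named so that
  the classical inequality can refer to it.\<close>

definition ln0 :: "real \<Rightarrow> real" where "ln0 x = (if x > 0 then ln x else 0)"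

text \<open>If p > R * q, then p at most 1 forces q < 1 / R, so the tail term is present and equals
  -w * p * ln q, while w * p * ln p is at most 0. The tail condition involves q only, so that
  summing the tail over the eigenvalues p leaves just the total weight on q.\<close>

lemma weighted_ln0_diff_le:
  fixes p q w R :: real
  assumes p: "0 \<le> p" "p \<le> 1" and q: "0 \<le> q" and w: "0 \<le> w" and R: "1 \<le> R"
    and supp: "q = 0 \<Longrightarrow> w * p = 0"
  shows "w * p * (ln0 p - ln0 q) \<le> w * (p - q) + (5 + 4 * ln R) * (w * (sqrt p - sqrt q)\<^sup>2)
    + (if 0 < q \<and> q < 1 / R then w * p * (- ln q) else 0)"
proof -
  have K: "5 + 4 * ln R \<ge> 5" using R by simp
  have nn: "0 \<le> (5 + 4 * ln R) * (w * (sqrt p - sqrt q)\<^sup>2)" using K w by simp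
  have tail: "0 \<le> (if 0 < q \<and> q < 1 / R then w * p * (- ln q) else 0)"
  proof (cases "0 < q \<and> q < 1 / R")
    case True
    then have "q < 1" using R by (smt (verit) divide_le_eq_1)
    then show ?thesis using True p w by (auto simp: mult_nonneg_nonpos)
  qed auto
  consider "q = 0" | "q > 0" "p = 0" | "q > 0" "p > 0" "p \<le> R * q" | "q > 0" "p > 0" "p > R * q"
    using p q by fastforce
  then show ?thesis
  proof cases
    case 1
    then show ?thesis using supp nn by auto
  next
    case 2
    \<comment> \<open>At p = 0 the squared difference is q, so five copies of it absorb the
      -q.\<close>
    have "0 \<le> w * (p - q) + 5 * (w * (sqrt p - sqrt q)\<^sup>2)" using 2 w by simp
    also have "\<dots> \<le> w * (p - q) + (5 + 4 * ln R) * (w * (sqrt p - sqrt q)\<^sup>2)"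
      using K w by (intro add_left_mono mult_right_mono) auto
    finally show ?thesis using tail 2 by simp
  next
    case 3
    have "w * (p * (ln p - ln q)) \<le> w * ((p - q) + (5 + 4 * ln R) * (sqrt p - sqrt q)\<^sup>2)"
      using mult_ln_ratio_le[OF 3(2,1,3) R] w by (rule mult_left_mono)
    then show ?thesis using tail 3 by (simp add: ln0_def algebra_simps)
  next
    case 4
    have "R * q < 1" using 4 p by simp
    then have q': "q < 1 / R" using R by (simp add: field_simps)
    have "q \<le> R * q" using 4 R by simp
    then have "0 \<le> w * (p - q)" using 4 w by (intro mult_nonneg_nonneg) linarith+
    moreover have "w * p * ln p \<le> 0"
      using 4 p w by (intro mult_nonneg_nonpos) auto
    ultimately show ?thesis using nn 4 q' by (simp add: ln0_def algebra_simps)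
  qed
qed

text \<open>With t the fourth root of q, r is at most t^2 and -ln q = 4 * (-ln t) is at most 4 / t,
  so the product is at most 4 * t. The eighth power in the hypothesis makes t at most 1 /
  x^2.\<close>

lemma mult_neg_ln_le:
  fixes q r x :: real
  assumes q: "0 < q" "q < 1 / x ^ 8" and x: "1 \<le> x" and r: "0 \<le> r" "r\<^sup>2 \<le> q"
  shows "r * (- ln q) \<le> 4 / x\<^sup>2"
proof -
  define t where "t = sqrt (sqrt q)"
  have t: "t > 0" using q unfolding t_def by simp
  have t2: "t\<^sup>2 = sqrt q" and t4: "t ^ 4 = q"
    using q power_mult[of t 2 2] by (auto simp: t_def)
  have "t ^ 4 \<le> (1 / x\<^sup>2) ^ 4"
    using q(2) by (simp add: t4 power_divide flip: power_mult)
  then have tx: "t \<le> 1 / x\<^sup>2"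
    by (rule power_le_imp_le_base[of _ 3, simplified]) (use x in auto)
  have lnq: "- ln q = 4 * (- ln t)" using t by (simp add: t4[symmetric] ln_realpow)
  have "- ln t = ln (1 / t)" using t by (simp add: ln_div)
  also have "\<dots> \<le> 1 / t" using ln_le_minus_one[of "1 / t"] t by simp
  finally have lnt: "- ln t \<le> 1 / t" .
  have "t < 1"
  proof (rule ccontr)
    assume "\<not> t < 1"
    then have "1 \<le> t ^ 4" by simp
    moreover have "1 / x ^ 8 \<le> 1" using x by simp
    ultimately show False using q t4 by linarith
  qed
  then have "0 \<le> - ln t" using t by simp
  moreover have "r \<le> t\<^sup>2" unfolding t2 using r by (simp add: real_le_rsqrt)
  ultimately have "r * (- ln t) \<le> t\<^sup>2 * (1 / t)"
    using lnt r by (intro mult_mono) auto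
  also have "\<dots> = t" using t by (simp add: power2_eq_square)
  finally have "r * (- ln t) \<le> 1 / x\<^sup>2" using tx by simp
  then show ?thesis unfolding lnq by simp
qed

section \<open>Summation against doubly stochastic weights\<close>

lemma sum_weights:
  fixes w :: "nat \<Rightarrow> nat \<Rightarrow> real"
  assumes "\<And>i. i < N \<Longrightarrow> (\<Sum>j<N. w i j) = 1"
  shows "(\<Sum>i<N. \<Sum>j<N. w i j * f i) = (\<Sum>i<N. f i)"
  by (rule sum.cong) (use assms in \<open>auto simp flip: sum_distrib_right\<close>)

lemma sum_weights':
  fixes w :: "nat \<Rightarrow> nat \<Rightarrow> real"
  assumes "\<And>j. j < N \<Longrightarrow> (\<Sum>i<N. w i j) = 1"
  shows "(\<Sum>i<N. \<Sum>j<N. w i j * f j) = (\<Sum>j<N. f j)"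
  by (subst sum.swap, rule sum.cong) (use assms in \<open>auto simp flip: sum_distrib_right\<close>)

text \<open>All matrices are gone here. The product structure of the second state enters only
  through the last hypothesis, which serves three times: for the inclusion of supports, for keeping
  \<eta> below 2, and for the tail.\<close>

lemma classical_relative_entropy_le:
  fixes p q :: "nat \<Rightarrow> real" and w :: "nat \<Rightarrow> nat \<Rightarrow> real" and d :: nat
  defines "N \<equiv> d * d"
  defines "\<eta> \<equiv> (\<Sum>i<N. \<Sum>j<N. w i j * (sqrt (p i) - sqrt (q j))\<^sup>2)"
  assumes w: "\<And>i j. i < N \<Longrightarrow> j < N \<Longrightarrow> 0 \<le> w i j"
    and row: "\<And>i. i < N \<Longrightarrow> (\<Sum>j<N. w i j) = 1"
    and col: "\<And>j. j < N \<Longrightarrow> (\<Sum>i<N. w i j) = 1"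
    and p: "\<And>i. i < N \<Longrightarrow> 0 \<le> p i" and p1: "(\<Sum>i<N. p i) = 1"
    and q: "\<And>j. j < N \<Longrightarrow> 0 \<le> q j" and q1: "(\<Sum>j<N. q j) = 1"
    and r: "\<And>j. j < N \<Longrightarrow> (\<Sum>i<N. w i j * p i)\<^sup>2 \<le> q j"
  shows "(\<Sum>i<N. \<Sum>j<N. w i j * p i * (ln0 (p i) - ln0 (q j))) \<le> 84 * \<eta> * ln (real d / \<eta>)"
    (is "?D \<le> _")
proof -
  define r' where "r' j = (\<Sum>i<N. w i j * p i)" for j
  have r'0: "0 \<le> r' j" if "j < N" for j
    unfolding r'_def using w p that by (intro sum_nonneg) auto
  have r'q: "(r' j)\<^sup>2 \<le> q j" if "j < N" for j using r[OF that] unfolding r'_def .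
  have r'1: "(\<Sum>j<N. r' j) = 1"
    unfolding r'_def by (subst sum.swap) (simp add: sum_weights[OF row] p1)
  have ple1: "p i \<le> 1" if "i < N" for i
    using member_le_sum[of i "{..<N}" p] that p p1 by auto
  \<comment> \<open>If q j = 0 then r' j = 0, and a vanishing sum of nonnegative terms vanishes
    termwise.\<close>
  have supp: "w i j * p i = 0" if "i < N" "j < N" "q j = 0" for i j
  proof -
    have "r' j = 0" using r'q[of j] that by simp
    then show ?thesis unfolding r'_def using that w p
      by (subst (asm) sum_nonneg_eq_0_iff) auto
  qed
  have \<eta>0: "0 \<le> \<eta>" unfolding \<eta>_def using w by (intro sum_nonneg) auto
  have N0: "N > 0" using p1 by (cases N) auto
  then have d1: "d \<ge> 1" unfolding N_def by (cases d) auto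
  \<comment> \<open>Start of a chain bounding the affinity of the two distributions below by 1 / N:
    Cauchy-Schwarz for r', then r' j at most sqrt (q j), then p i at most sqrt (p i).\<close>
  have "(\<Sum>j<N. r' j)\<^sup>2 / real N \<le> (\<Sum>j<N. (r' j)\<^sup>2)"
  proof -
    have "0 \<le> (\<Sum>j<N. (r' j - 1 / N)\<^sup>2)" by (intro sum_nonneg) auto
    also have "\<dots> = (\<Sum>j<N. (r' j)\<^sup>2) - 2 / N * (\<Sum>j<N. r' j) + (\<Sum>j<N. (1/N)\<^sup>2)"
      by (simp add: power2_diff sum.distrib sum_subtractf sum_distrib_left sum_divide_distrib algebra_simps)
    also have "\<dots> = (\<Sum>j<N. (r' j)\<^sup>2) - 1 / N"
      using N0 by (simp add: r'1 power2_eq_square)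
    finally show ?thesis by (simp add: r'1)
  qed
  also have "(\<Sum>j<N. (r' j)\<^sup>2) \<le> (\<Sum>j<N. r' j * sqrt (q j))"
    unfolding power2_eq_square
    using r'0 r'q by (intro sum_mono mult_left_mono real_le_rsqrt) auto
  also have "\<dots> = (\<Sum>i<N. \<Sum>j<N. w i j * (p i * sqrt (q j)))"
    unfolding r'_def sum_distrib_right by (subst sum.swap) (simp add: mult_ac)
  also have "\<dots> \<le> (\<Sum>i<N. \<Sum>j<N. w i j * (sqrt (p i) * sqrt (q j)))"
  proof (intro sum_mono mult_left_mono mult_right_mono)
    fix i assume "i \<in> {..<N}"
    then have "(p i)\<^sup>2 \<le> p i" using p[of i] ple1[of i] by (simp add: power2_eq_square mult_left_le)
    then show "p i \<le> sqrt (p i)" by (rule real_le_rsqrt)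
  qed (use w q in auto)
  finally have F: "1 / real N \<le> (\<Sum>i<N. \<Sum>j<N. w i j * (sqrt (p i) * sqrt (q j)))"
    by (simp add: r'1)
  \<comment> \<open>Expanding the square: \<eta> is 2 minus twice the affinity, as both
    distributions have total mass 1.\<close>
  have "\<eta> = (\<Sum>i<N. \<Sum>j<N. w i j * p i) + (\<Sum>i<N. \<Sum>j<N. w i j * q j)
      - 2 * (\<Sum>i<N. \<Sum>j<N. w i j * (sqrt (p i) * sqrt (q j)))"
    unfolding \<eta>_def sum_distrib_left sum.distrib[symmetric] sum_subtractf[symmetric]
    using p q by (intro sum.cong refl) (simp add: power2_diff algebra_simps)
  then have \<eta>le: "\<eta> \<le> 2 - 2 / N" using F by (simp add: sum_weights[OF row] sum_weights'[OF col] p1 q1)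
  show ?thesis
  proof (cases "\<eta> = 0")
    case True
    \<comment> \<open>The right-hand side is 0 in this case. Every pair of positive weight has p i =
      q j, so the left-hand side vanishes too.\<close>
    have "w i j * p i * (ln0 (p i) - ln0 (q j)) = 0" if "i < N" "j < N" for i j
    proof -
      have "(\<Sum>j<N. w i j * (sqrt (p i) - sqrt (q j))\<^sup>2) = 0"
        using True that w unfolding \<eta>_def by (subst (asm) sum_nonneg_eq_0_iff) (auto intro!: sum_nonneg)
      then have "w i j * (sqrt (p i) - sqrt (q j))\<^sup>2 = 0"
        using that w by (subst (asm) sum_nonneg_eq_0_iff) auto
      then show ?thesis by auto
    qed
    then have "?D = 0" by (intro sum.neutral ballI) auto
    then show ?thesis using True by simp
  next
    case False
    then have \<eta>pos: "\<eta> > 0" using \<eta>0 by simp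
    define x where "x = real d / \<eta>"
    \<comment> \<open>For d = 1 the bound 2 - 2 / N is 0, against \<eta> > 0.\<close>
    have "d \<noteq> 1"
    proof
      assume "d = 1"
      then show False using \<eta>le \<eta>pos by (simp add: N_def)
    qed
    then consider "d = 2" | "d \<ge> 3" using d1 by linarith
    \<comment> \<open>The critical case is d = 2, where 2 - 2 / N = 3 / 2 gives exactly this; the
      crude bound 2 would only yield x at least 1 and no positive lower bound on ln x. From d = 3 on
      the crude bound suffices.\<close>
    then have "4 / 3 * \<eta> \<le> d"
    proof cases
      case 1
      then show ?thesis using \<eta>le by (simp add: N_def)
    next
      case 2
      have "\<eta> \<le> 2" using \<eta>le by (smt (verit) divide_nonneg_nonneg of_nat_0_le_iff)
      moreover have "real d \<ge> 3" using 2 by simp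
      ultimately show ?thesis by argo
    qed
    then have x43: "4 / 3 \<le> x" using \<eta>pos unfolding x_def by (simp add: field_simps)
    have "ln (1 / x) \<le> 1 / x - 1" using x43 by (intro ln_le_minus_one) auto
    also have "1 / x \<le> 3 / 4" using x43 by (simp add: field_simps)
    finally have lnx: "1 / 4 \<le> ln x" using x43 by (simp add: ln_div)
    \<comment> \<open>With this power each column of the tail is at most 4 / x^2 by
      \<open>mult_neg_ln_le\<close>, and the d^2 columns add up to 4 * \<eta>^2. The price is only a
      factor 8 in ln R.\<close>
    define R where "R = x ^ 8"
    have R1: "1 \<le> R" unfolding R_def using x43 by (intro one_le_power) auto
    have lnR: "ln R = 8 * ln x" unfolding R_def using x43 by (simp add: ln_realpow)
    let ?t = "\<lambda>i j. if 0 < q j \<and> q j < 1 / R then w i j * p i * (- ln (q j)) else 0"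
    have "?D \<le> (\<Sum>i<N. \<Sum>j<N. w i j * (p i - q j)
        + (5 + 4 * ln R) * (w i j * (sqrt (p i) - sqrt (q j))\<^sup>2) + ?t i j)"
      using p ple1 q w R1 supp by (intro sum_mono weighted_ln0_diff_le) auto
    also have "\<dots> = (\<Sum>i<N. \<Sum>j<N. w i j * p i) - (\<Sum>i<N. \<Sum>j<N. w i j * q j)
        + (5 + 4 * ln R) * \<eta> + (\<Sum>i<N. \<Sum>j<N. ?t i j)"
      unfolding \<eta>_def sum_distrib_left sum.distrib[symmetric] sum_subtractf[symmetric]
      by (intro sum.cong refl) (simp add: algebra_simps)
    \<comment> \<open>The linear terms cancel because p and q have equal total mass.\<close>
    also have "\<dots> = (5 + 4 * ln R) * \<eta> + (\<Sum>i<N. \<Sum>j<N. ?t i j)"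
      by (simp add: sum_weights[OF row] sum_weights'[OF col] p1 q1)
    \<comment> \<open>Summing over i first turns the weights w i j * p i into r' j.\<close>
    also have "(\<Sum>i<N. \<Sum>j<N. ?t i j) = (\<Sum>j<N. \<Sum>i<N. ?t i j)" by (rule sum.swap)
    also have "\<dots> \<le> (\<Sum>j<N. 4 / x\<^sup>2)"
    proof (rule sum_mono)
      fix j assume j: "j \<in> {..<N}"
      show "(\<Sum>i<N. ?t i j) \<le> 4 / x\<^sup>2"
      proof (cases "0 < q j \<and> q j < 1 / R")
        case True
        then have "(\<Sum>i<N. ?t i j) = r' j * (- ln (q j))"
          unfolding r'_def by (simp add: sum_distrib_right sum_negf)
        also have "\<dots> \<le> 4 / x\<^sup>2"
          using True j r'0 r'q x43 unfolding R_def by (intro mult_neg_ln_le) auto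
        finally show ?thesis .
      next
        case False
        then show ?thesis by (simp only: if_False) simp
      qed
    qed
    also have "(\<Sum>j<N. 4 / x\<^sup>2) = 4 * \<eta> * \<eta>"
      using d1 \<eta>pos unfolding x_def N_def by (simp add: power2_eq_square)
    \<comment> \<open>One factor \<eta> is bounded by 2, so the tail contributes 8 * \<eta>; with
      the 5 from above this makes 13.\<close>
    also have "\<dots> \<le> 4 * \<eta> * 2"
      using \<eta>le \<eta>pos by (intro mult_left_mono) (auto intro: order_trans)
    finally have "?D \<le> \<eta> * (13 + 32 * ln x)" by (simp add: lnR algebra_simps)
    \<comment> \<open>Since ln x is at least 1 / 4, 13 is at most 52 * ln x, and 52 + 32 =
      84.\<close>
    also have "\<dots> \<le> \<eta> * (84 * ln x)" using lnx \<eta>pos by (intro mult_left_mono) auto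
    finally show ?thesis unfolding x_def by (simp add: mult_ac)
  qed
qed

section \<open>Reduction to the classical inequality\<close>

lemma sum_if_div_eq:
  fixes f :: "nat \<Rightarrow> real"
  assumes "k < n"
  shows "(\<Sum>j<n*m. f j * (if j div m = k then 1 else 0)) = (\<Sum>l<m. f (k * m + l))"
proof -
  have "(\<Sum>j<n*m. f j * (if j div m = k then 1 else 0))
      = (\<Sum>a<n. if a = k then (\<Sum>l<m. f (a * m + l)) else 0)"
    unfolding sum_lessThan_mult by (intro sum.cong refl) auto
  then show ?thesis using assms by (simp add: sum.delta)
qed

lemma sum_if_mod_eq:
  fixes f :: "nat \<Rightarrow> real"
  assumes "l < m"
  shows "(\<Sum>j<n*m. f j * (if j mod m = l then 1 else 0)) = (\<Sum>k<n. f (k * m + l))"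
proof -
  have "(\<Sum>j<n*m. f j * (if j mod m = l then 1 else 0))
      = (\<Sum>a<n. \<Sum>b<m. if b = l then f (a * m + b) else 0)"
    unfolding sum_lessThan_mult by (intro sum.cong refl) auto
  then show ?thesis using assms by (simp add: sum.delta)
qed

text \<open>r lists the diagonal of \<rho> in the product of the eigenbases of its reduced states.
  Summing over l tests \<rho> against the projector on the k-th eigenvector tensored with the
  identity; this sees only the reduced state and returns its eigenvalue a k. The other marginal is
  symmetric.\<close>

lemma product_diagonalised_marginals:
  fixes p a b :: "nat \<Rightarrow> real"
  assumes U: "U \<in> carrier_mat (d * d) (d * d)" "unitary U"
    and V: "V \<in> carrier_mat d d" "unitary V" and X: "X \<in> carrier_mat d d" "unitary X"
    and \<rho>: "\<rho> = U * real_diag (d * d) p * adj U"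
    and \<rho>A: "ptrace_B d \<rho> = V * real_diag d a * adj V"
    and \<rho>B: "ptrace_A d \<rho> = X * real_diag d b * adj X"
  defines "r \<equiv> \<lambda>j. \<Sum>i<d*d. overlap U (kron V X) i j * p i"
  shows "k < d \<Longrightarrow> (\<Sum>l<d. r (k * d + l)) = a k" "l < d \<Longrightarrow> (\<Sum>k<d. r (k * d + l)) = b l"
proof -
  have \<rho>c: "\<rho> \<in> carrier_mat (d * d) (d * d)" using U \<rho> by auto
  have K: "kron V X \<in> carrier_mat (d * d) (d * d)" using V X by simp
  \<comment> \<open>Pairing r with g is the expectation in \<rho> of the observable with eigenvalues
    g in the product basis; indicator functions g give the marginals.\<close>
  have sr: "(\<Sum>j<d*d. r j * g j) = Re (mtrace (\<rho> * (kron V X * real_diag (d * d) g * adj (kron V X))))" for g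
  proof -
    have "(\<Sum>j<d*d. r j * g j) = (\<Sum>i<d*d. \<Sum>j<d*d. overlap U (kron V X) i j * (p i * g j))"
      unfolding r_def sum_distrib_right by (subst sum.swap) (simp add: mult_ac)
    then show ?thesis unfolding \<rho> mtrace_diagonalised_mult[OF U(1) K] by simp
  qed
  have one: "Y * real_diag d (\<lambda>_. 1) * adj Y = 1\<^sub>m d" if "Y \<in> carrier_mat d d" "unitary Y" for Y
    using that by (simp add: unitaryD flip: one_real_diag)
  have self: "Re (mtrace ((Y * real_diag d f * adj Y) * (Y * real_diag d (\<lambda>i. if i = k then 1 else 0) * adj Y))) = f k"
    if "Y \<in> carrier_mat d d" "unitary Y" "k < d" for Y f k
  proof -
    have "(\<Sum>i<d. \<Sum>j<d. overlap Y Y i j * (f i * (if j = k then 1 else 0)))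
        = (\<Sum>i<d. \<Sum>j<d. if j = k then (if i = k then f i else 0) else 0)"
      using that by (intro sum.cong refl) (auto simp: overlap_self)
    also have "\<dots> = f k" using that by (simp add: sum.delta)
    finally show ?thesis unfolding mtrace_diagonalised_mult[OF that(1) that(1)] by simp
  qed
  {
    assume k: "k < d"
    have "(\<Sum>l<d. r (k * d + l)) = (\<Sum>j<d*d. r j * (if j div d = k then 1 else 0))"
      using k by (rule sum_if_div_eq[symmetric])
    also have "\<dots> = Re (mtrace (\<rho> * kron (V * real_diag d (\<lambda>i. if i = k then 1 else 0) * adj V)
        (X * real_diag d (\<lambda>_. 1) * adj X)))"
      unfolding sr kron_diagonalised[OF V(1) X(1)] by simp
    also have "\<dots> = Re (mtrace (ptrace_B d \<rho> * (V * real_diag d (\<lambda>i. if i = k then 1 else 0) * adj V)))"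
      unfolding one[OF X] using V by (subst mtrace_mult_kron_one(1)[OF \<rho>c]) auto
    also have "\<dots> = a k" unfolding \<rho>A by (rule self[OF V k])
    finally show "(\<Sum>l<d. r (k * d + l)) = a k" .
  next
    assume l: "l < d"
    have "(\<Sum>k<d. r (k * d + l)) = (\<Sum>j<d*d. r j * (if j mod d = l then 1 else 0))"
      using l by (rule sum_if_mod_eq[symmetric])
    also have "\<dots> = Re (mtrace (\<rho> * kron (V * real_diag d (\<lambda>_. 1) * adj V)
        (X * real_diag d (\<lambda>i. if i = l then 1 else 0) * adj X)))"
      unfolding sr kron_diagonalised[OF V(1) X(1)] by simp
    also have "\<dots> = Re (mtrace (ptrace_A d \<rho> * (X * real_diag d (\<lambda>i. if i = l then 1 else 0) * adj X)))"
      unfolding one[OF V] using X by (subst mtrace_mult_kron_one(2)[OF \<rho>c]) auto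
    also have "\<dots> = b l" unfolding \<rho>B by (rule self[OF X l])
    finally show "(\<Sum>k<d. r (k * d + l)) = b l" .
  }
qed

section \<open>Hellinger distance and relative entropy as classical sums\<close>

lemma mtrace_minus:
  "A \<in> carrier_mat n n \<Longrightarrow> B \<in> carrier_mat n n \<Longrightarrow> mtrace (A - B) = mtrace A - mtrace B"
  unfolding mtrace_def by (auto simp: sum_subtractf)

text \<open>The trace of the square expands, by cyclicity, into the two traces minus twice the mixed
  term. Row and column sums equal to 1 turn the single sums over p and q into double sums, and the
  square can be completed termwise.\<close>

lemma hellinger_sq_diagonalised:
  assumes U: "U \<in> carrier_mat n n" "unitary U" and K: "K \<in> carrier_mat n n" "unitary K"
    and p: "\<And>i. i < n \<Longrightarrow> 0 \<le> p i" and q: "\<And>i. i < n \<Longrightarrow> 0 \<le> q i"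
  shows "hellinger_sq (U * real_diag n p * adj U) (K * real_diag n q * adj K)
    = (\<Sum>i<n. \<Sum>j<n. overlap U K i j * (sqrt (p i) - sqrt (q j))\<^sup>2)"
proof -
  define S where "S = U * real_diag n (sqrt \<circ> p) * adj U"
  define T where "T = K * real_diag n (sqrt \<circ> q) * adj K"
  have S: "S \<in> carrier_mat n n" and T: "T \<in> carrier_mat n n"
    using U K unfolding S_def T_def by auto
  note ov = sum_overlap[OF U K]
  have sq: "(Y * real_diag n (sqrt \<circ> f) * adj Y) * (Y * real_diag n (sqrt \<circ> f) * adj Y) = Y * real_diag n f * adj Y"
    if Y: "Y \<in> carrier_mat n n" "unitary Y" and f: "\<And>i. i < n \<Longrightarrow> 0 \<le> f i" for Y f
  proof -
    have "(Y * real_diag n (sqrt \<circ> f) * adj Y) * (Y * real_diag n (sqrt \<circ> f) * adj Y)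
        = Y * (real_diag n (sqrt \<circ> f) * ((adj Y * Y) * real_diag n (sqrt \<circ> f))) * adj Y"
      using Y by (simp add: assoc_mult_square[of _ n])
    also have "real_diag n (sqrt \<circ> f) * ((adj Y * Y) * real_diag n (sqrt \<circ> f)) = real_diag n f"
      using Y f by (intro eq_matI)
        (auto simp: unitaryD mult_real_diag_index[of _ n] simp del: index_mult_mat(1) simp flip: of_real_mult)
    finally show ?thesis .
  qed
  have "(S - T) * (S - T) = (S * S - S * T) - (T * S - T * T)"
    using minus_mult_distrib_mat[OF S T minus_carrier_mat[OF T], of S]
    by (simp add: mult_minus_distrib_mat[OF S S T] mult_minus_distrib_mat[OF T S T])
  then have "mtrace ((S - T) * (S - T)) = (mtrace (S * S) - mtrace (S * T)) - (mtrace (T * S) - mtrace (T * T))"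
    using S T by (simp add: mtrace_minus[of _ n] minus_carrier_mat)
  also have "mtrace (T * S) = mtrace (S * T)" using T S by (rule mtrace_comm)
  also have "S * S = U * real_diag n p * adj U" unfolding S_def using U p by (rule sq)
  also have "T * T = K * real_diag n q * adj K" unfolding T_def using K q by (rule sq)
  finally have "mtrace ((S - T) * (S - T)) = complex_of_real ((\<Sum>i<n. p i) + (\<Sum>j<n. q j)
      - 2 * (\<Sum>i<n. \<Sum>j<n. overlap U K i j * (sqrt (p i) * sqrt (q j))))"
    unfolding mtrace_diagonalised[OF U] mtrace_diagonalised[OF K] S_def T_def
      mtrace_diagonalised_mult[OF U(1) K(1)]
    by simp
  moreover have "(\<Sum>i<n. p i) + (\<Sum>j<n. q j) - 2 * (\<Sum>i<n. \<Sum>j<n. overlap U K i j * (sqrt (p i) * sqrt (q j)))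
      = (\<Sum>i<n. \<Sum>j<n. overlap U K i j * (sqrt (p i) - sqrt (q j))\<^sup>2)"
  proof -
    have pq: "(\<Sum>i<n. p i) = (\<Sum>i<n. \<Sum>j<n. overlap U K i j * p i)"
      "(\<Sum>j<n. q j) = (\<Sum>i<n. \<Sum>j<n. overlap U K i j * q j)"
      using sum_weights[OF ov(1)] sum_weights'[OF ov(2)] by auto
    show ?thesis
      unfolding pq sum_distrib_left sum.distrib[symmetric] sum_subtractf[symmetric]
      using p q by (intro sum.cong refl) (simp add: power2_diff algebra_simps)
  qed
  moreover have "msqrt (U * real_diag n p * adj U) = S" "msqrt (K * real_diag n q * adj K) = T"
    unfolding msqrt_def S_def T_def by (rule mat_fun_eq[OF U refl] mat_fun_eq[OF K refl])+
  ultimately show ?thesis unfolding hellinger_sq_def by simp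
qed

text \<open>The term with ln \<rho> is a single sum over the eigenvalues p; unit row sums spread it
  over j, where it joins the mixed term.\<close>

lemma rel_entropy_diagonalised:
  assumes U: "U \<in> carrier_mat n n" "unitary U" and K: "K \<in> carrier_mat n n" "unitary K"
  shows "rel_entropy (U * real_diag n p * adj U) (K * real_diag n q * adj K)
    = (\<Sum>i<n. \<Sum>j<n. overlap U K i j * p i * (ln0 (p i) - ln0 (q j)))"
proof -
  let ?\<rho> = "U * real_diag n p * adj U" and ?\<sigma> = "K * real_diag n q * adj K"
  have ln0: "(\<lambda>x. if x > 0 then ln x else 0) = ln0" by (auto simp: ln0_def)
  have ln\<rho>: "mln ?\<rho> = U * real_diag n (ln0 \<circ> p) * adj U"
    and ln\<sigma>: "mln ?\<sigma> = K * real_diag n (ln0 \<circ> q) * adj K"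
    unfolding mln_def ln0 by (rule mat_fun_eq[OF U refl] mat_fun_eq[OF K refl])+
  note ov = sum_overlap[OF U K]
  have "mtrace (?\<rho> * (mln ?\<rho> - mln ?\<sigma>)) = mtrace (?\<rho> * mln ?\<rho>) - mtrace (?\<rho> * mln ?\<sigma>)"
    unfolding ln\<rho> ln\<sigma> using U K
    by (simp add: mult_minus_distrib_mat[of _ n n _ n] mtrace_minus[of _ n])
  also have "mtrace (?\<rho> * mln ?\<rho>) = complex_of_real (\<Sum>i<n. p i * ln0 (p i))"
    unfolding ln\<rho> mtrace_diagonalised_mult[OF U(1) U(1)]
    using U by (auto simp: overlap_self if_distrib[where f = "\<lambda>x. x * _"] sum.delta'
        intro!: sum.cong cong: if_cong)
  also have "mtrace (?\<rho> * mln ?\<sigma>) = complex_of_real (\<Sum>i<n. \<Sum>j<n. overlap U K i j * (p i * ln0 (q j)))"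
    unfolding ln\<sigma> mtrace_diagonalised_mult[OF U(1) K(1)] by simp
  finally have "rel_entropy ?\<rho> ?\<sigma> = (\<Sum>i<n. p i * ln0 (p i)) - (\<Sum>i<n. \<Sum>j<n. overlap U K i j * (p i * ln0 (q j)))"
    unfolding rel_entropy_def by simp
  also have "(\<Sum>i<n. p i * ln0 (p i)) = (\<Sum>i<n. \<Sum>j<n. overlap U K i j * (p i * ln0 (p i)))"
    by (rule sum_weights[OF ov(1), symmetric])
  finally show ?thesis by (simp add: algebra_simps flip: sum_subtractf)
qed

section \<open>The quantum inequality from the classical one\<close>

theorem theorem4p1:
  "\<exists>C::real. \<forall>(d::nat) (\<rho>::complex mat).
     \<rho> \<in> carrier_mat (d*d) (d*d) \<longrightarrow> density \<rho> \<longrightarrow>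
     (let \<eta> = hellinger_sq \<rho> (kron (ptrace_B d \<rho>) (ptrace_A d \<rho>))
      in mutual_info d \<rho> \<le> C * \<eta> * ln (real d / \<eta>))"
proof (intro exI allI impI)
  fix d :: nat and \<rho> :: "complex mat"
  assume \<rho>c: "\<rho> \<in> carrier_mat (d*d) (d*d)" and dens: "density \<rho>"
  then have psd: "psd \<rho>" and h: "hermitian \<rho>" and tr: "mtrace \<rho> = 1"
    unfolding density_def psd_def by auto
  obtain U p where U: "U \<in> carrier_mat (d*d) (d*d)" "unitary U"
    and \<rho>: "\<rho> = U * real_diag (d*d) p * adj U"
    using spectral_theorem[OF \<rho>c h] by blast
  obtain V a where V: "V \<in> carrier_mat d d" "unitary V" and \<rho>A: "ptrace_B d \<rho> = V * real_diag d a * adj V"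
    using spectral_theorem[OF ptrace_carrier(2) hermitian_ptrace(2)[OF \<rho>c h]] by blast
  obtain X b where X: "X \<in> carrier_mat d d" "unitary X" and \<rho>B: "ptrace_A d \<rho> = X * real_diag d b * adj X"
    using spectral_theorem[OF ptrace_carrier(1) hermitian_ptrace(1)[OF \<rho>c h]] by blast
  define K where "K = kron V X"
  define q where "q j = a (j div d) * b (j mod d)" for j
  have K: "K \<in> carrier_mat (d*d) (d*d)" "unitary K"
    unfolding K_def using V X unitary_kron[OF V X] by auto
  have \<sigma>: "kron (ptrace_B d \<rho>) (ptrace_A d \<rho>) = K * real_diag (d*d) q * adj K"
    unfolding \<rho>A \<rho>B kron_diagonalised[OF V(1) X(1)] K_def q_def by simp
  have p0: "0 \<le> p i" if "i < d*d" for i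
    using psd_eigenvalue_nonneg[OF U _ that] psd \<rho> by simp
  have "complex_of_real (\<Sum>i<d*d. p i) = 1"
    using tr mtrace_diagonalised[OF U, of p] \<rho> by simp
  then have p1: "(\<Sum>i<d*d. p i) = 1" by (metis of_real_eq_1_iff)
  define r where "r j = (\<Sum>i<d*d. overlap U K i j * p i)" for j
  note marg = product_diagonalised_marginals[OF U V X \<rho> \<rho>A \<rho>B, folded K_def, folded r_def]
  have r0: "0 \<le> r j" for j
    unfolding r_def using p0 overlap_nonneg by (intro sum_nonneg) auto
  \<comment> \<open>Each r is one nonnegative summand of both marginals through it.\<close>
  have rle: "r (k * d + l) \<le> a k" "r (k * d + l) \<le> b l" if "k < d" "l < d" for k l
    using marg(1)[OF that(1)] marg(2)[OF that(2)] that r0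
      member_le_sum[of l "{..<d}" "\<lambda>l. r (k * d + l)"] member_le_sum[of k "{..<d}" "\<lambda>k. r (k * d + l)"]
    by auto
  \<comment> \<open>Positivity of the reduced states is read off from r, which lies below their
    eigenvalues.\<close>
  have a0: "0 \<le> a k" and b0: "0 \<le> b k" if "k < d" for k
    using rle[OF that that] r0[of "k * d + k"] by linarith+
  \<comment> \<open>One factor r j is bounded by each marginal, and the product of the two marginals
    is q j.\<close>
  have rq: "(r j)\<^sup>2 \<le> q j" if "j < d*d" for j
  proof -
    note dm = div_mod_less[OF that]
    have "r j \<le> a (j div d)" "r j \<le> b (j mod d)" using rle[OF dm] by simp_all
    then show ?thesis unfolding q_def power2_eq_square using r0 a0[OF dm(1)] by (intro mult_mono) auto
  qed
  have q0: "0 \<le> q j" if "j < d*d" for j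
    using rq[OF that] by (rule order_trans[OF zero_le_power2])
  have ov: "(\<Sum>j<d*d. r j) = 1"
    unfolding r_def by (subst sum.swap) (simp add: sum_weights[OF sum_overlap(1)[OF U K]] p1)
  have "(\<Sum>k<d. a k) = 1"
    using ov by (simp add: sum_lessThan_mult marg)
  moreover have "(\<Sum>k<d. b k) = (\<Sum>l<d. \<Sum>k<d. r (k * d + l))"
    by (simp add: marg)
  then have "(\<Sum>k<d. b k) = 1"
    using ov by (subst (asm) sum.swap) (simp add: sum_lessThan_mult)
  moreover have "(\<Sum>j<d*d. q j) = (\<Sum>k<d. a k) * (\<Sum>k<d. b k)"
    unfolding sum_product sum_lessThan_mult q_def by (intro sum.cong refl) auto
  ultimately have q1: "(\<Sum>j<d*d. q j) = 1" by simp
  have hell: "hellinger_sq \<rho> (K * real_diag (d*d) q * adj K)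
      = (\<Sum>i<d*d. \<Sum>j<d*d. overlap U K i j * (sqrt (p i) - sqrt (q j))\<^sup>2)"
    unfolding \<rho> using U K p0 q0 by (rule hellinger_sq_diagonalised)
  have rel: "rel_entropy \<rho> (K * real_diag (d*d) q * adj K)
      = (\<Sum>i<d*d. \<Sum>j<d*d. overlap U K i j * p i * (ln0 (p i) - ln0 (q j)))"
    unfolding \<rho> using U K by (rule rel_entropy_diagonalised)
  \<comment> \<open>The constant 84 is the one of
    \<open>classical_relative_entropy_le\<close>.\<close>
  show "let \<eta> = hellinger_sq \<rho> (kron (ptrace_B d \<rho>) (ptrace_A d \<rho>))
      in mutual_info d \<rho> \<le> 84 * \<eta> * ln (real d / \<eta>)"
    unfolding Let_def mutual_info_def \<sigma> hell rel
    by (rule classical_relative_entropy_le)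
      (use overlap_nonneg sum_overlap[OF U K] p0 p1 q0 q1 rq[unfolded r_def] in auto)
qed

end
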